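(* Let $A(x;1,1;v):=\sum_{i\ge1}\sum_{n\ge1}|\mathcal{M}_{n,i}|\,x^n v^{i-1}$. The generating function for the number of nonempty Motzkin words with respect to the length (marked by $x$) and the value of the last symbol (marked by $v$) is $$A(x;1,1;v)\cdot v=\frac{xv(1-v) + x^2vM(x)}{1 - v + x - v x + v^2 x}.$$
   Context: A Motzkin word of length $n\ge 1$ is a word $w=w_1\cdots w_n$ over the positive integers such that $w_1=1$, and $1\le w_k\le w_{k-1}+1$ and $w_{k-1}\ne w_k$ for $k=2,\dots,n$. $\mathcal{M}_{n,i}$ is the set of Motzkin words of length $n$ whose last symbol is $i$. $M(x)=\sum_{n\ge0}m_nx^n=\dfrac{1-x-\sqrt{1-2x-3x^2}}{2x^2}$ is the generating function of the Motzkin numbers $m_n$ ($1,1,2,4,9,21,\dots$). *)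

theory Defs
  imports "HOL-Computational_Algebra.Computational_Algebra" Complex_Main
begin

text \<open>The letter \<open>w\<^sub>k\<close> is \<open>w ! (k - 1)\<close>: list positions start at 0.\<close>

definition motzkin_word :: "nat list \<Rightarrow> bool" where
  "motzkin_word w \<longleftrightarrow>
     length w \<ge> 1 \<and> w ! 0 = 1 \<and>
     (\<forall>k. 1 \<le> k \<and> k < length w \<longrightarrow>
        1 \<le> w ! k \<and> w ! k \<le> w ! (k - 1) + 1 \<and> w ! (k - 1) \<noteq> w ! k)"

definition motzkin_words :: "nat \<Rightarrow> nat \<Rightarrow> nat list set" where
  "motzkin_words n i = {w. motzkin_word w \<and> length w = n \<and> last w = i}"

lemma motzkin_words_0 [simp]: "motzkin_words 0 i = {}"
  by (auto simp: motzkin_words_def motzkin_word_def)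

lemma motzkin_word_nth_le:
  assumes "motzkin_word w" "k < length w"
  shows "w ! k \<le> k + 1"
  using assms(2)
proof (induction k)
  case 0
  then show ?case using assms(1) by (simp add: motzkin_word_def)
next
  case (Suc k)
  have "w ! Suc k \<le> w ! (Suc k - 1) + 1"
    using assms(1) Suc.prems unfolding motzkin_word_def by (metis le_add1 plus_1_eq_Suc)
  then show ?case using Suc by simp
qed

lemma finite_motzkin_words [simp]: "finite (motzkin_words n i)"
proof (rule finite_subset)
  show "motzkin_words n i \<subseteq> {w. set w \<subseteq> {..n} \<and> length w = n}"
  proof
    fix w assume w: "w \<in> motzkin_words n i"
    then have "w ! k \<le> n" if "k < length w" for k
      using motzkin_word_nth_le[of w k] that by (auto simp: motzkin_words_def)
    then show "w \<in> {w. set w \<subseteq> {..n} \<and> length w = n}"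
      using w by (auto simp: motzkin_words_def in_set_conv_nth)
  qed
qed (simp add: finite_lists_length_eq)

text \<open>
  Series in \<open>x\<close> and \<open>v\<close> are elements of \<open>\<real>[[v]][[x]]\<close>, i.e. of type \<^typ>\<open>real fps fps\<close>:
  the outer indeterminate is \<open>x\<close> and the inner one is \<open>v\<close>.
\<close>

definition var_x :: "real fps fps" where
  "var_x = fps_X"

definition var_v :: "real fps fps" where
  "var_v = fps_const fps_X"

text \<open>
  The coefficient of \<open>x\<^sup>n v\<^sup>j\<close> is the number of words of length \<open>n\<close> with last symbol \<open>j + 1\<close>
  (so \<open>j = i - 1\<close>); the coefficients at \<open>n = 0\<close> vanish because words are nonempty.
\<close>

definition last_symbol_gf :: "real fps fps" where
  "last_symbol_gf = Abs_fps (\<lambda>n. Abs_fps (\<lambda>j. of_nat (card (motzkin_words n (j + 1)))))"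

text \<open>
  The square root is the formal one with constant term 1.  The numerator is divisible by
  \<open>2x\<^sup>2\<close>, see \<open>motzkin_numerator\<close>, so the quotient is exact.
\<close>

definition motzkin_series :: "real fps" where
  "motzkin_series =
     (1 - fps_X - fps_radical root 2 (1 - 2 * fps_X - 3 * fps_X ^ 2)) / (2 * fps_X ^ 2)"

definition motzkin_gf :: "real fps fps" where
  "motzkin_gf = Abs_fps (\<lambda>n. fps_const (fps_nth motzkin_series n))"

lemma motzkin_radical_square:
  "(fps_radical root 2 (1 - 2 * fps_X - 3 * fps_X ^ 2)) ^ 2 =
     (1 - 2 * fps_X - 3 * fps_X ^ 2 :: real fps)"
  using power_radical[of "1 - 2 * fps_X - 3 * fps_X ^ 2 :: real fps" root 1]
  by (simp add: numeral_2_eq_2)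

lemma motzkin_numerator:
  "2 * fps_X ^ 2 * motzkin_series =
     1 - fps_X - fps_radical root 2 (1 - 2 * fps_X - 3 * fps_X ^ 2)"
proof -
  define S :: "real fps" where "S = fps_radical root 2 (1 - 2 * fps_X - 3 * fps_X ^ 2)"
  have sq: "S ^ 2 = 1 - 2 * fps_X - 3 * fps_X ^ 2"
    unfolding S_def by (rule motzkin_radical_square)
  have S0: "fps_nth S 0 = 1" by (simp add: S_def)
  have "fps_nth (S ^ 2) 1 = fps_nth (1 - 2 * fps_X - 3 * fps_X ^ 2 :: real fps) 1"
    by (simp only: sq)
  then have S1: "fps_nth S 1 = -1"
    by (simp add: power2_eq_square fps_mult_nth_1 S0 numeral_fps_const)
  have "fps_X ^ 2 dvd 1 - fps_X - S"
  proof -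
    have "fps_nth (1 - fps_X - S) k = 0" if "k < 2" for k
      using that S0 S1 by (cases k) (auto simp: less_Suc_eq numeral_2_eq_2)
    then have "1 - fps_X - S = fps_X ^ 2 * fps_shift 2 (1 - fps_X - S)"
      by (intro fps_ext) (auto simp: fps_X_power_mult_nth simp del: add_2_eq_Suc add_2_eq_Suc')
    then show ?thesis by (metis dvd_triv_left)
  qed
  moreover have "is_unit (2 :: real fps)" by (simp add: numeral_fps_const)
  ultimately have "2 * fps_X ^ 2 dvd 1 - fps_X - S"
    by (simp add: mult_unit_dvd_iff')
  then show ?thesis
    unfolding motzkin_series_def S_def by (rule dvd_mult_div_cancel)
qed

lemma motzkin_series_functional_eq:
  "motzkin_series = 1 + fps_X * motzkin_series + fps_X ^ 2 * motzkin_series ^ 2"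
proof -
  define S :: "real fps" where "S = fps_radical root 2 (1 - 2 * fps_X - 3 * fps_X ^ 2)"
  let ?m = motzkin_series
  have S: "S = 1 - fps_X - 2 * fps_X ^ 2 * ?m"
    using motzkin_numerator by (simp add: S_def)
  have "(1 - fps_X - 2 * fps_X ^ 2 * ?m) ^ 2 = 1 - 2 * fps_X - 3 * fps_X ^ 2"
    using motzkin_radical_square unfolding S[symmetric] S_def .
  then have "4 * fps_X ^ 2 * ?m = 4 * fps_X ^ 2 * (1 + fps_X * ?m + fps_X ^ 2 * ?m ^ 2)"
    by algebra
  then show ?thesis by (subst (asm) mult_left_cancel) auto
qed

text \<open>The coefficients of \<^const>\<open>motzkin_series\<close> are the Motzkin numbers:\<close>

lemma motzkin_series_nth_0: "fps_nth motzkin_series 0 = 1"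
  by (subst motzkin_series_functional_eq) simp

lemma motzkin_series_nth_Suc:
  "fps_nth motzkin_series (Suc n) = fps_nth motzkin_series n +
     (\<Sum>i<n. fps_nth motzkin_series i * fps_nth motzkin_series (n - 1 - i))"
proof -
  let ?m = motzkin_series
  have "fps_nth ?m (Suc n) = fps_nth (1 + fps_X * ?m + fps_X ^ 2 * ?m ^ 2) (Suc n)"
    using motzkin_series_functional_eq by simp
  also have "\<dots> = fps_nth ?m n + (if n = 0 then 0 else fps_nth (?m ^ 2) (n - 1))"
    by (auto simp: fps_X_power_mult_nth)
  also have "(if n = 0 then 0 else fps_nth (?m ^ 2) (n - 1)) =
      (\<Sum>i<n. fps_nth ?m i * fps_nth ?m (n - 1 - i))"
    by (cases n) (auto simp: power2_eq_square fps_mult_nth atLeast0AtMost lessThan_Suc_atMost)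
  finally show ?thesis .
qed

text \<open>
  Division in \<^typ>\<open>real fps fps\<close> is total; by the next two lemmas, dividing by the
  denominator \<open>1 - v + x - v x + v\<^sup>2 x\<close> is multiplication by its inverse.
\<close>

lemma denominator_is_unit:
  "(1 - var_v + var_x - var_v * var_x + var_v\<^sup>2 * var_x) * inverse (1 - var_v + var_x - var_v * var_x + var_v\<^sup>2 * var_x) = 1"
proof -
  let ?d = "1 - var_v + var_x - var_v * var_x + var_v\<^sup>2 * var_x"
  have d0: "fps_nth ?d 0 = 1 - fps_X"
    by (simp add: var_x_def var_v_def)
  have "fps_nth ?d 0 * inverse (fps_nth ?d 0) = 1"
    unfolding d0 by (rule inverse_mult_eq_1') simp
  then show ?thesis
    unfolding fps_inverse_def by (rule fps_right_inverse)
qed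

lemma divide_denominator:
  "f / (1 - var_v + var_x - var_v * var_x + var_v\<^sup>2 * var_x) = f * inverse (1 - var_v + var_x - var_v * var_x + var_v\<^sup>2 * var_x)"
  by (rule fps_divide_unit') (simp add: subdegree_eq_0_iff var_x_def var_v_def)

end

theory Submission
  imports Defs
begin

text \<open>
  Let \<open>P\<^sub>n(u)\<close> be the sum of \<open>u\<^bsup>last w - 1\<^esup>\<close> over the Motzkin words \<open>w\<close> of length \<open>n\<close>.  A word
  ending in \<open>l\<close> may be continued by every letter of \<open>1, \<dots>, l + 1\<close> except \<open>l\<close>, and summing the
  geometric series turns this into
    \<open>(1 - u) P\<^sub>n\<^sub>+\<^sub>1(u) = P\<^sub>n(1) - (1 - u + u\<^sup>2) P\<^sub>n(u)\<close> (\<open>last_symbol_poly_recurrence\<close>).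
  For \<open>u = v\<close> this says that the generating function times the denominator
  \<open>1 - v + x (1 - v + v\<^sup>2)\<close> is \<open>x (1 - v) + x T(x)\<close>, where \<open>T(x)\<close> is the sum of \<open>P\<^sub>n(1) x\<^sup>n\<close>,
  that is, the series counting all nonempty words by length.

  The unknown \<open>T\<close> is found by the kernel method.  The denominator vanishes at
  \<open>v = V = 1 + x M(x)\<close>, so substituting \<open>V\<close> for \<open>v\<close> yields \<open>T = V - 1 = x M(x)\<close>.  Since \<open>V\<close> has
  constant term 1, it cannot be substituted into an arbitrary power series in \<open>v\<close>; but the
  recurrence holds in every commutative ring, so it can be used at \<open>u = V\<close> in \<open>\<real>[[x]]\<close> for one
  \<open>n\<close> at a time.  Multiplied by \<open>x\<^sup>n\<close> it telescopes, and the one term that remains besides \<open>T\<close>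
  and \<open>x M(x)\<close> is divisible by an arbitrarily high power of \<open>x\<close> (\<open>word_count_eq_motzkin_number\<close>).
\<close>

definition words_of_length :: "nat \<Rightarrow> nat list set" where
  "words_of_length n = {w. motzkin_word w \<and> length w = n}"

definition last_symbol_poly :: "nat \<Rightarrow> 'a::comm_ring_1 \<Rightarrow> 'a" where
  "last_symbol_poly n u = (\<Sum>w\<in>words_of_length n. u ^ (last w - 1))"

text \<open>
  Ensures that the truncated subtraction in the exponent \<open>last w - 1\<close> identifies no two last letters.
\<close>

lemma motzkin_word_last_pos:
  assumes "motzkin_word w"
  shows "last w \<ge> 1"
proof -
  have "w \<noteq> []" and first: "w ! 0 = 1"
    using assms by (auto simp: motzkin_word_def)
  have step: "1 \<le> w ! k" if "1 \<le> k" "k < length w" for k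
    using assms that unfolding motzkin_word_def by blast
  have "1 \<le> w ! (length w - 1)"
    using first step[of "length w - 1"] \<open>w \<noteq> []\<close> by (cases "length w = 1") (simp_all add: Suc_le_eq)
  then show ?thesis using \<open>w \<noteq> []\<close> by (simp add: last_conv_nth)
qed

lemma motzkin_word_snoc:
  assumes "w \<noteq> []"
  shows "motzkin_word (w @ [j]) \<longleftrightarrow> motzkin_word w \<and> j \<in> {1..last w + 1} - {last w}"
proof -
  define step where "step z k \<longleftrightarrow> 1 \<le> z ! k \<and> z ! k \<le> z ! (k - 1) + 1 \<and> z ! (k - 1) \<noteq> z ! k"
    for z :: "nat list" and k
  have word: "motzkin_word z \<longleftrightarrow>
      z \<noteq> [] \<and> z ! 0 = 1 \<and> (\<forall>k. 1 \<le> k \<and> k < length z \<longrightarrow> step z k)" for z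
    unfolding motzkin_word_def step_def by (simp add: Suc_le_eq)
  have len: "1 \<le> length w"
    using assms by (simp add: Suc_le_eq)
  have old: "step (w @ [j]) k \<longleftrightarrow> step w k" if "k < length w" for k
    using that by (simp add: step_def nth_append less_imp_diff_less)
  have new: "step (w @ [j]) (length w) \<longleftrightarrow> j \<in> {1..last w + 1} - {last w}"
    using assms by (auto simp: step_def nth_append last_conv_nth)
  have "(\<forall>k. 1 \<le> k \<and> k < length (w @ [j]) \<longrightarrow> step (w @ [j]) k) \<longleftrightarrow>
      (\<forall>k. 1 \<le> k \<and> k < length w \<longrightarrow> step (w @ [j]) k) \<and> step (w @ [j]) (length w)"
    using len by (simp only: length_append_singleton less_Suc_eq) blast
  also have "\<dots> \<longleftrightarrow> (\<forall>k. 1 \<le> k \<and> k < length w \<longrightarrow> step w k) \<and>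
      j \<in> {1..last w + 1} - {last w}"
    unfolding new using old by blast
  finally have steps: "(\<forall>k. 1 \<le> k \<and> k < length (w @ [j]) \<longrightarrow> step (w @ [j]) k) \<longleftrightarrow>
      (\<forall>k. 1 \<le> k \<and> k < length w \<longrightarrow> step w k) \<and> j \<in> {1..last w + 1} - {last w}" .
  have "w @ [j] \<noteq> []" "(w @ [j]) ! 0 = w ! 0"
    using assms by (simp_all add: nth_append)
  then show ?thesis
    unfolding word steps using assms by simp
qed

lemma words_of_length_0: "words_of_length 0 = {}"
  by (auto simp: words_of_length_def motzkin_word_def)

lemma words_of_length_1: "words_of_length 1 = {[1]}"
  by (auto simp: words_of_length_def motzkin_word_def length_Suc_conv)

lemma words_of_length_Suc:
  assumes "n \<ge> 1"
  shows "words_of_length (Suc n) =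
    (\<lambda>(w, j). w @ [j]) ` (SIGMA w:words_of_length n. {1..last w + 1} - {last w})"
    (is "?L = ?R")
proof (intro set_eqI iffI)
  fix z assume z: "z \<in> ?L"
  then obtain w j where "z = w @ [j]" "length w = n"
    by (auto simp: words_of_length_def length_Suc_conv_rev)
  then show "z \<in> ?R"
    using z assms motzkin_word_snoc[of w j] by (force simp: words_of_length_def)
next
  fix z assume "z \<in> ?R"
  then obtain w j where "z = w @ [j]" "motzkin_word w" "length w = n"
      "j \<in> {1..last w + 1} - {last w}"
    unfolding words_of_length_def by fast
  then show "z \<in> ?L"
    using assms motzkin_word_snoc[of w j] by (cases "w = []") (auto simp: words_of_length_def)
qed

lemma finite_words_of_length: "finite (words_of_length n)"
proof (induction n)
  case 0
  then show ?case by (simp add: words_of_length_0)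
next
  case (Suc n)
  then show ?case
    using words_of_length_1 words_of_length_Suc[of n] by (cases "n = 0") auto
qed

lemma last_symbol_poly_0: "last_symbol_poly 0 u = 0"
  by (simp add: last_symbol_poly_def words_of_length_0)

lemma last_symbol_poly_1: "last_symbol_poly (Suc 0) u = 1"
  using words_of_length_1 by (simp add: last_symbol_poly_def)

lemma admissible_letters_sum:
  fixes u :: "'a::comm_ring_1"
  assumes "l \<ge> 1"
  shows "(1 - u) * (\<Sum>j\<in>{1..l + 1} - {l}. u ^ (j - 1)) =
    1 - (1 - u + u\<^sup>2) * u ^ (l - 1)"
proof -
  have geometric: "(\<Sum>j\<in>{1..l + 1}. u ^ (j - 1)) = (\<Sum>j<l + 1. u ^ j)"
    by (rule sum.reindex_bij_witness[of _ Suc "\<lambda>j. j - 1"]) auto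
  have "(\<Sum>j\<in>{1..l + 1} - {l}. u ^ (j - 1)) = (\<Sum>j<l + 1. u ^ j) - u ^ (l - 1)"
    using assms by (subst sum_diff1) (auto simp only: geometric, auto)
  then have "(1 - u) * (\<Sum>j\<in>{1..l + 1} - {l}. u ^ (j - 1)) =
      (1 - u) * (\<Sum>j<l + 1. u ^ j) - (1 - u) * u ^ (l - 1)"
    by (simp only: right_diff_distrib)
  also have "(1 - u) * (\<Sum>j<l + 1. u ^ j) = 1 - u ^ (l + 1)"
    by (rule one_diff_power_eq[symmetric])
  also have "u ^ (l + 1) = u\<^sup>2 * u ^ (l - 1)"
    using assms by (simp flip: power_add)
  finally show ?thesis by (simp add: algebra_simps)
qed

text \<open>
  Stated for an arbitrary commutative ring, because it is applied both to the indeterminate \<open>v\<close> and to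
  the root \<open>V\<close> of the kernel, a power series in \<open>x\<close>.
\<close>

lemma last_symbol_poly_recurrence:
  fixes u :: "'a::comm_ring_1"
  assumes "n \<ge> 1"
  shows "(1 - u) * last_symbol_poly (Suc n) u =
    last_symbol_poly n 1 - (1 - u + u\<^sup>2) * last_symbol_poly n u"
proof -
  let ?W = "words_of_length n" and ?J = "\<lambda>w. {1..last w + 1} - {last w}"
  have "last_symbol_poly (Suc n) u = (\<Sum>(w, j)\<in>Sigma ?W ?J. u ^ (j - 1))"
    unfolding last_symbol_poly_def words_of_length_Suc[OF assms]
    by (subst sum.reindex) (auto simp: inj_on_def intro!: sum.cong)
  also have "\<dots> = (\<Sum>w\<in>?W. \<Sum>j\<in>?J w. u ^ (j - 1))"
    by (rule sum.Sigma[symmetric]) (auto simp: finite_words_of_length)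
  finally have "(1 - u) * last_symbol_poly (Suc n) u =
      (\<Sum>w\<in>?W. (1 - u) * (\<Sum>j\<in>?J w. u ^ (j - 1)))"
    by (simp add: sum_distrib_left)
  also have "\<dots> = (\<Sum>w\<in>?W. 1 - (1 - u + u\<^sup>2) * u ^ (last w - 1))"
    by (intro sum.cong refl admissible_letters_sum)
       (use motzkin_word_last_pos in \<open>auto simp: words_of_length_def\<close>)
  also have "\<dots> = last_symbol_poly n 1 - (1 - u + u\<^sup>2) * last_symbol_poly n u"
    by (simp add: last_symbol_poly_def sum_subtractf sum_distrib_left)
  finally show ?thesis .
qed

lemma last_symbol_gf_nth: "fps_nth last_symbol_gf n = last_symbol_poly n fps_X"
proof (rule fps_ext)
  fix j
  have "motzkin_words n (j + 1) = {w \<in> words_of_length n. j = last w - 1}"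
    using motzkin_word_last_pos by (fastforce simp: motzkin_words_def words_of_length_def)
  then show "fps_nth (fps_nth last_symbol_gf n) j = fps_nth (last_symbol_poly n fps_X) j"
    by (simp add: last_symbol_gf_def last_symbol_poly_def fps_sum_nth finite_words_of_length
        sum.If_cases Int_def)
qed

lemma last_symbol_poly_one_of_nat:
  "(last_symbol_poly n 1 :: 'a::comm_ring_1) = of_nat (card (words_of_length n))"
  by (simp add: last_symbol_poly_def)

text \<open>
  This is the functional equation \<open>M = 1 + x M + x\<^sup>2 M\<^sup>2\<close> in terms of \<open>V = 1 + x M\<close>.  Multiplied by
  \<open>x\<close> it says that \<open>V\<close> is a root of the kernel \<open>1 - v + x (1 - v + v\<^sup>2)\<close>.
\<close>

lemma kernel_root:
  fixes V :: "real fps"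
  defines "V \<equiv> 1 + fps_X * motzkin_series"
  shows "1 - V + V\<^sup>2 = motzkin_series"
proof -
  have "1 - V + V\<^sup>2 = 1 + fps_X * motzkin_series + fps_X\<^sup>2 * motzkin_series\<^sup>2"
    unfolding V_def by (simp add: power2_eq_square algebra_simps)
  then show ?thesis
    unfolding motzkin_series_functional_eq[symmetric] .
qed

text \<open>
  With \<open>V = 1 + x M\<close>, the kernel equation turns the recurrence at \<open>u = V\<close> into
  \<open>x\<^sup>n P\<^sub>n\<^sub>+\<^sub>1(1) = M (x\<^sup>n P\<^sub>n\<^sub>+\<^sub>1(V) - x\<^bsup>n+1\<^esup> P\<^sub>n\<^sub>+\<^sub>2(V))\<close>, whose right-hand side telescopes.
\<close>

lemma kernel_telescope:
  fixes V :: "real fps"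
  defines "V \<equiv> 1 + fps_X * motzkin_series"
  shows "(\<Sum>n<N. fps_X ^ n * last_symbol_poly (Suc n) 1) =
    motzkin_series * (1 - fps_X ^ N * last_symbol_poly (Suc N) V)"
proof (induction N)
  case 0
  then show ?case by (simp add: last_symbol_poly_1)
next
  case (Suc N)
  let ?P = "\<lambda>n. last_symbol_poly n V" and ?t = "last_symbol_poly (Suc N) 1 :: real fps"
  have "(1 - V) * ?P (Suc (Suc N)) = ?t - (1 - V + V\<^sup>2) * ?P (Suc N)"
    by (rule last_symbol_poly_recurrence) simp
  also have "1 - V + V\<^sup>2 = motzkin_series"
    unfolding V_def by (rule kernel_root)
  finally have "?t = (1 - V) * ?P (Suc (Suc N)) + motzkin_series * ?P (Suc N)"
    by simp
  also have "1 - V = - (fps_X * motzkin_series)"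
    by (simp add: V_def)
  finally have t: "?t = motzkin_series * (?P (Suc N) - fps_X * ?P (Suc (Suc N)))"
    by (simp add: algebra_simps)
  show ?case
    by (simp add: Suc.IH t algebra_simps)
qed

text \<open>
  The coefficient of \<open>x\<^sup>n\<close> in the telescoped identity for \<open>N = n + 1\<close>, where the remainder is
  divisible by \<open>x\<^bsup>n+1\<^esup>\<close>.
\<close>

lemma word_count_eq_motzkin_number:
  "real (card (words_of_length (Suc n))) = fps_nth motzkin_series n"
proof -
  define R where "R = motzkin_series * last_symbol_poly (Suc (Suc n)) (1 + fps_X * motzkin_series)"
  have "(\<Sum>k<Suc n. fps_X ^ k * last_symbol_poly (Suc k) 1) = motzkin_series - fps_X ^ Suc n * R"
    unfolding kernel_telescope R_def by (simp add: algebra_simps)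
  then have "fps_nth (\<Sum>k<Suc n. fps_X ^ k * last_symbol_poly (Suc k) 1) n =
      fps_nth (motzkin_series - fps_X ^ Suc n * R) n"
    by (rule arg_cong)
  also have "\<dots> = fps_nth motzkin_series n"
    by (simp only: fps_sub_nth fps_X_power_mult_nth) simp
  also have "fps_nth (\<Sum>k<Suc n. fps_X ^ k * last_symbol_poly (Suc k) 1) n =
      (\<Sum>k<Suc n. if k = n then real (card (words_of_length (Suc k))) else 0)"
    unfolding fps_sum_nth last_symbol_poly_one_of_nat
    by (intro sum.cong refl) (auto simp: fps_X_power_mult_nth fps_of_nat[symmetric])
  finally show ?thesis by simp
qed

text \<open>
  For lengths at least 1 this is the recurrence at \<open>u = v\<close>, with \<open>P\<^sub>n(1)\<close> replaced by the Motzkin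
  number \<open>m\<^sub>n\<^sub>-\<^sub>1\<close>; the word of length 1 contributes \<open>x (1 - v)\<close>.
\<close>

lemma last_symbol_gf_times_kernel:
  "last_symbol_gf * (1 - var_v + var_x - var_v * var_x + var_v\<^sup>2 * var_x) =
    var_x * (1 - var_v) + var_x\<^sup>2 * motzkin_gf"
    (is "?A * ?D = ?N")
proof -
  let ?P = "\<lambda>n. last_symbol_poly n fps_X :: real fps"
  have D: "?A * ?D = fps_const (1 - fps_X) * ?A + fps_X * (fps_const (1 - fps_X + fps_X\<^sup>2) * ?A)"
    by (simp add: var_v_def var_x_def algebra_simps flip: fps_const_sub fps_const_add fps_const_power)
  have N: "?N = fps_X * fps_const (1 - fps_X) + fps_X * (fps_X * motzkin_gf)"
    by (simp add: var_v_def var_x_def algebra_simps power2_eq_square flip: fps_const_sub)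
  show ?thesis
  proof (rule fps_ext)
    fix n
    show "fps_nth (?A * ?D) n = fps_nth ?N n"
    proof (cases n)
      case 0
      then show ?thesis by (simp add: D N last_symbol_gf_nth last_symbol_poly_0)
    next
      case (Suc m)
      show ?thesis
      proof (cases m)
        case 0
        then show ?thesis using Suc
          by (simp add: D N last_symbol_gf_nth last_symbol_poly_0 last_symbol_poly_1)
      next
        case (Suc k)
        have "fps_nth (?A * ?D) n = (1 - fps_X) * ?P (Suc m) + (1 - fps_X + fps_X\<^sup>2) * ?P m"
          by (simp add: D \<open>n = Suc m\<close> last_symbol_gf_nth)
        also have "\<dots> = last_symbol_poly m 1"
          using last_symbol_poly_recurrence[of m "fps_X :: real fps"] Suc by simp
        also have "\<dots> = fps_const (fps_nth motzkin_series k)"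
          using word_count_eq_motzkin_number[of k] Suc
          by (simp add: last_symbol_poly_one_of_nat flip: fps_of_nat)
        also have "\<dots> = fps_nth ?N n"
          unfolding N by (simp add: \<open>n = Suc m\<close> Suc motzkin_gf_def)
        finally show ?thesis .
      qed
    qed
  qed
qed

theorem corollary3p2:
  shows "last_symbol_gf * var_v =
    (var_x * var_v * (1 - var_v) + var_x\<^sup>2 * var_v * motzkin_gf) /
    (1 - var_v + var_x - var_v * var_x + var_v\<^sup>2 * var_x)"
proof -
  let ?D = "1 - var_v + var_x - var_v * var_x + var_v\<^sup>2 * var_x"
  have "var_x * var_v * (1 - var_v) + var_x\<^sup>2 * var_v * motzkin_gf =
      var_v * (last_symbol_gf * ?D)"
    unfolding last_symbol_gf_times_kernel by (simp add: algebra_simps)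
  then have "(var_x * var_v * (1 - var_v) + var_x\<^sup>2 * var_v * motzkin_gf) / ?D =
      last_symbol_gf * var_v * (?D * inverse ?D)"
    unfolding divide_denominator by (simp only: mult_ac)
  then show ?thesis
    by (simp only: denominator_is_unit mult_1_right)
qed

end
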